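(* Let $\beta\ge 2$ and $t\ge 0$ be integers, and let $G$ be a cactus with $2\beta$ vertices, exactly $t$ cycles, and a perfect matching. Then $$SO(G)\le \Phi(\beta,t)=(\beta+t-1)\sqrt{(\beta+t)^{2}+4}+\sqrt{(\beta+t)^{2}+1}+\sqrt{5}\,(\beta-t-1)+2\sqrt{2}\,t,$$ with equality if and only if $G\cong H^{*}(2\beta,t)$.
   Context: All graphs are finite, simple and connected. For a graph $G$, $d_u$ denotes the degree of vertex $u$, and the Sombor index is $SO(G)=\sum_{uv\in E(G)}\sqrt{d_u^2+d_v^2}$. A cactus is a connected graph in which any two cycles have at most one common vertex. (A cactus with $2\beta$ vertices has at most $\beta-1$ cycles.) For integers $\beta\ge 1$ and $0\le t\le \beta-1$, $H^{*}(2\beta,t)$ denotes the graph with a center vertex $c$, consisting of $t$ triangles that pairwise share only the vertex $c$, one pendant vertex adjacent to $c$, and $\beta-t-1$ paths $c\,u_i\,v_i$ of length 2 attached at $c$ (with $d_{u_i}=2$, $d_{v_i}=1$), all these pieces otherwise disjoint; it has $2\beta$ vertices, $t$ cycles, $d_c=\beta+t$, and a perfect matching, and $SO(H^{*}(2\beta,t))=\Phi(\beta,t)$. *)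

theory Defs
  imports Complex_Main
begin

text \<open>A graph is a pair (V, E) of a vertex set and a set of edges, each edge being a
two-element subset of V (finite simple graph).\<close>

definition simple_graph :: "'a set \<Rightarrow> 'a set set \<Rightarrow> bool" where
  "simple_graph V E \<longleftrightarrow> finite V \<and> (\<forall>e\<in>E. \<exists>u v. e = {u, v} \<and> u \<in> V \<and> v \<in> V \<and> u \<noteq> v)"

definition adj :: "'a set set \<Rightarrow> 'a \<Rightarrow> 'a \<Rightarrow> bool" where
  "adj E u v \<longleftrightarrow> {u, v} \<in> E"

definition connected_graph :: "'a set \<Rightarrow> 'a set set \<Rightarrow> bool" where
  "connected_graph V E \<longleftrightarrow> V \<noteq> {} \<and>
     (\<forall>u\<in>V. \<forall>v\<in>V. (u, v) \<in> {(x, y). adj E x y}\<^sup>*)"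

definition degree :: "'a set set \<Rightarrow> 'a \<Rightarrow> nat" where
  "degree E v = card {e \<in> E. v \<in> e}"

text \<open>Sombor index: sum over edges uv of sqrt(d_u^2 + d_v^2).  For an edge e = {u,v}
with u \<noteq> v, the inner sum over the two endpoints equals d_u^2 + d_v^2.\<close>
definition sombor :: "'a set set \<Rightarrow> real" where
  "sombor E = (\<Sum>e\<in>E. sqrt (\<Sum>v\<in>e. (real (degree E v))^2))"

text \<open>A cycle (as a subgraph), identified by its edge set: given by a list of at least
three distinct vertices, consecutive ones (cyclically) adjacent.\<close>
definition is_cycle :: "'a set \<Rightarrow> 'a set set \<Rightarrow> 'a set set \<Rightarrow> bool" where
  "is_cycle V E C \<longleftrightarrow> (\<exists>vs. length vs \<ge> 3 \<and> distinct vs \<and> set vs \<subseteq> V \<and>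
      (\<forall>i < length vs. {vs ! i, vs ! ((i + 1) mod length vs)} \<in> E) \<and>
      C = {{vs ! i, vs ! ((i + 1) mod length vs)} | i. i < length vs})"

definition cycles :: "'a set \<Rightarrow> 'a set set \<Rightarrow> 'a set set set" where
  "cycles V E = {C. is_cycle V E C}"

text \<open>Cactus: connected graph in which any two (distinct) cycles have at most one
common vertex.\<close>
definition cactus :: "'a set \<Rightarrow> 'a set set \<Rightarrow> bool" where
  "cactus V E \<longleftrightarrow> simple_graph V E \<and> connected_graph V E \<and>
     (\<forall>C1\<in>cycles V E. \<forall>C2\<in>cycles V E. C1 \<noteq> C2 \<longrightarrow> card (\<Union>C1 \<inter> \<Union>C2) \<le> 1)"

definition perfect_matching :: "'a set \<Rightarrow> 'a set set \<Rightarrow> 'a set set \<Rightarrow> bool" where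
  "perfect_matching V E M \<longleftrightarrow> M \<subseteq> E \<and> (\<forall>v\<in>V. \<exists>!e. e \<in> M \<and> v \<in> e)"

definition has_perfect_matching :: "'a set \<Rightarrow> 'a set set \<Rightarrow> bool" where
  "has_perfect_matching V E \<longleftrightarrow> (\<exists>M. perfect_matching V E M)"

definition graph_iso :: "'a set \<Rightarrow> 'a set set \<Rightarrow> 'b set \<Rightarrow> 'b set set \<Rightarrow> bool" where
  "graph_iso V E V' E' \<longleftrightarrow> (\<exists>f. bij_betw f V V' \<and>
     (\<forall>u\<in>V. \<forall>v\<in>V. {u, v} \<in> E \<longleftrightarrow> {f u, f v} \<in> E'))"

text \<open>H*(2 beta, t) on vertex set {0..<2 beta}: center 0; triangles 0,2i+1,2i+2 (i<t);
pendant vertex 2t+1; paths 0,u_j,v_j with u_j = 2t+2+2j, v_j = 2t+3+2j (j < beta-t-1).\<close>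
definition Hstar_V :: "nat \<Rightarrow> nat \<Rightarrow> nat set" where
  "Hstar_V \<beta> t = {0..<2 * \<beta>}"

definition Hstar_E :: "nat \<Rightarrow> nat \<Rightarrow> nat set set" where
  "Hstar_E \<beta> t =
     {{0, 2*i+1} | i. i < t} \<union> {{0, 2*i+2} | i. i < t} \<union> {{2*i+1, 2*i+2} | i. i < t}
     \<union> {{0, 2*t+1}}
     \<union> {{0, 2*t+2+2*j} | j. j < \<beta> - t - 1} \<union> {{2*t+2+2*j, 2*t+3+2*j} | j. j < \<beta> - t - 1}"

definition Phi :: "nat \<Rightarrow> nat \<Rightarrow> real" where
  "Phi \<beta> t = (real \<beta> + real t - 1) * sqrt ((real \<beta> + real t)^2 + 4)
     + sqrt ((real \<beta> + real t)^2 + 1) + sqrt 5 * (real \<beta> - real t - 1) + 2 * sqrt 2 * real t"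

end

(*
  Put D = beta + t. For a cactus |E| = 2 beta - 1 + t and t <= beta - 1. For an edge uv, the edges
  at u or v together with the perfect matching M form a subset of E, so counting gives
  d_u + d_v <= D + 2, and <= D + 1 if uv is in M; in particular all degrees are at most D.

  If some vertex c has degree D, the edges at c and the matching exhaust E, which forces G = H*.

  Otherwise all degrees are at most D - 1. The D - 1 unmatched edges join vertices of degree at
  least 2, so by convexity each contributes at most sqrt ((D-1)^2 + 3^2), while a matched edge
  contributes at most d_u + d_v - (3 - sqrt 5), and the degrees sum to 2|E|. The resulting bound
  is strictly below Phi.
*)
theory Submission
  imports Defs
begin

text \<open>The estimate for matched edges is linear so that its sum depends only on the degree sum;
  3 - sqrt 5 makes it exact at degrees 1 and 2, the outer edges of the paths in
  \<open>Hstar\<close>. On \<open>Hstar\<close> it overshoots, by 1 + sqrt 5 - 2 sqrt 2 on each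
  triangle edge off the center and by up to sqrt 5 - 2 on the pendant edge. Together with the sharp
  value sqrt (D^2 + 2^2) on unmatched edges it would exceed Phi once D > 2; this forces the case
  distinction. Capping the degrees at D - 1 moves the worst pair from (D, 2) to (D - 1, 3), and the
  D - 1 savings sqrt (D^2 + 4) - sqrt ((D - 1)^2 + 9) pay for the overshoot. At D = 3 the saving
  vanishes, so that case is separate.

  The edge count is an induction over edges. Connectedness, hence being a cactus, can be lost when
  an edge is deleted, so the induction assumes pairwise edge-disjoint cycles instead.

  The Sombor index of \<open>Hstar\<close> is never computed: a vertex of degree D already gives the
  value Phi, and an isomorphism with \<open>Hstar\<close> only has to supply such a vertex.\<close>

section \<open>The cyclomatic number of a cactus\<close>

abbreviation reachable :: "'a set set \<Rightarrow> ('a \<times> 'a) set" where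
  "reachable E \<equiv> {(x, y). adj E x y}\<^sup>*"

lemma simple_graph_edge_subset: "simple_graph V E \<Longrightarrow> e \<in> E \<Longrightarrow> e \<subseteq> V"
  by (force simp: simple_graph_def)

lemma simple_graph_finite_edges: "simple_graph V E \<Longrightarrow> finite E"
  by (rule finite_subset[of _ "Pow V"]) (auto simp: simple_graph_def)

lemma equiv_reachable: "equiv UNIV (reachable E)"
proof (rule equivI)
  have "sym {(x, y). adj E x y}"
    by (auto simp: sym_def adj_def insert_commute)
  then show "sym (reachable E)" by (rule sym_rtrancl)
qed (auto simp: refl_rtrancl trans_rtrancl)

lemma reachable_insert:
  "(x, y) \<in> reachable (insert {u, v} E) \<longleftrightarrow> (x, y) \<in> reachable E \<or>
     (x, u) \<in> reachable E \<and> (v, y) \<in> reachable E \<or>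
     (x, v) \<in> reachable E \<and> (u, y) \<in> reachable E"
proof -
  have "{(x, y). adj (insert {u, v} E) x y} = insert (u, v) (insert (v, u) {(x, y). adj E x y})"
    by (auto simp: adj_def doubleton_eq_iff)
  then show ?thesis
    using equiv_reachable[of E]
    by (auto simp: rtrancl_insert equiv_def sym_def dest: rtrancl_trans)
qed

text \<open>The classes of \<open>u\<close> and \<open>v\<close> are replaced by their union, and
  every other class stays as it is.\<close>

lemma card_components_insert:
  assumes "finite V" "u \<in> V" "v \<in> V" "(u, v) \<notin> reachable E"
  shows "card (V // reachable E) = Suc (card (V // reachable (insert {u, v} E)))"
proof -
  define cl where "cl x = reachable E `` {x}" for x
  define cl' where "cl' x = reachable (insert {u, v} E) `` {x}" for x
  have reach: "(x, y) \<in> reachable E \<longleftrightarrow> cl x = cl y" for x y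
    unfolding cl_def using eq_equiv_class_iff[OF equiv_reachable[of E], of x y] by simp
  have mem_cl: "y \<in> cl x \<longleftrightarrow> cl x = cl y" for x y
    unfolding reach[symmetric] by (simp add: cl_def)
  have mem_cl': "y \<in> cl' x \<longleftrightarrow> cl x = cl y \<or> cl x = cl u \<and> cl v = cl y \<or> cl x = cl v \<and> cl u = cl y"
    for x y
    by (simp only: cl'_def Image_singleton_iff reachable_insert reach)
  have quot: "V // reachable E = cl ` V" "V // reachable (insert {u, v} E) = cl' ` V"
    by (auto simp: quotient_def cl_def cl'_def)
  have ne: "cl u \<noteq> cl v" using assms(4) reach by simp
  have merged: "cl' x = cl u \<union> cl v" if "cl x = cl u \<or> cl x = cl v" for x
    using that by (intro set_eqI, unfold Un_iff mem_cl mem_cl') metis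
  have kept: "cl' x = cl x" if "cl x \<noteq> cl u" "cl x \<noteq> cl v" for x
    using that by (intro set_eqI, unfold Un_iff mem_cl mem_cl') metis
  have "cl' ` V = insert (cl u \<union> cl v) (cl ` V - {cl u, cl v})" (is "_ = insert ?M ?Q")
  proof (intro equalityI subsetI)
    fix X assume "X \<in> cl' ` V"
    then obtain x where "x \<in> V" "X = cl' x" by blast
    then show "X \<in> insert ?M ?Q" using merged[of x] kept[of x] by auto
  next
    fix X assume "X \<in> insert ?M ?Q"
    then consider "X = cl' u" | x where "x \<in> V" "X = cl' x"
      using merged[of u] kept by auto
    then show "X \<in> cl' ` V" using assms(2) by cases auto
  qed
  moreover have "?M \<notin> ?Q"
  proof
    assume *: "?M \<in> ?Q"
    then obtain x where x: "?M = cl x" by blast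
    have "u \<in> ?M" by (simp add: mem_cl)
    then have "cl x = cl u" using x mem_cl by metis
    then show False using x * by simp
  qed
  moreover have "card ?Q = card (cl ` V) - 2"
    using assms(2,3) ne by (subst card_Diff_subset) auto
  moreover have "card {cl u, cl v} \<le> card (cl ` V)"
    using assms(1-3) by (intro card_mono) auto
  ultimately show ?thesis using ne assms(1) unfolding quot by simp
qed

text \<open>Induction on the walk: a step to a new vertex extends the path, a step back onto the
  path truncates it at that vertex, so the vertices stay distinct.\<close>

lemma reachable_imp_path:
  assumes "(u, v) \<in> reachable E"
  shows "\<exists>p. p \<noteq> [] \<and> hd p = u \<and> last p = v \<and> distinct p \<and>
    (\<forall>i. Suc i < length p \<longrightarrow> {p ! i, p ! Suc i} \<in> E)"
  using assms
proof (induction rule: rtrancl_induct)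
  case base
  show ?case by (rule exI[of _ "[u]"]) simp
next
  case (step y z)
  then obtain p where p: "p \<noteq> []" "hd p = u" "last p = y" "distinct p"
    "\<And>i. Suc i < length p \<Longrightarrow> {p ! i, p ! Suc i} \<in> E" by blast
  show ?case
  proof (cases "z \<in> set p")
    case True
    then obtain k where k: "k < length p" "p ! k = z" by (auto simp: in_set_conv_nth)
    let ?q = "take (Suc k) p"
    have q: "?q \<noteq> []" "hd ?q = u" "distinct ?q" using p by simp_all
    have len: "length ?q = Suc k" using k(1) by simp
    then have "last ?q = z" using k by (subst last_conv_nth[OF q(1)]) simp
    moreover have "\<forall>i. Suc i < length ?q \<longrightarrow> {?q ! i, ?q ! Suc i} \<in> E"
      using p(5) by simp
    ultimately show ?thesis using q by blast
  next
    case False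
    show ?thesis
    proof (rule exI[of _ "p @ [z]"], intro conjI allI impI)
      fix i assume "Suc i < length (p @ [z])"
      then consider "Suc i < length p" | "Suc i = length p" by fastforce
      then show "{(p @ [z]) ! i, (p @ [z]) ! Suc i} \<in> E"
      proof cases
        case 1 then show ?thesis using p(5) by (simp add: nth_append)
      next
        case 2
        then have "(p @ [z]) ! i = y" using p(1,3) by (simp add: nth_append last_conv_nth flip: 2)
        moreover have "(p @ [z]) ! Suc i = z" using 2 by (simp add: nth_append)
        ultimately show ?thesis using step.hyps by (simp add: adj_def)
      qed
    qed (use p False in auto)
  qed
qed

section \<open>Cycles under insertion of an edge\<close>

lemma is_cycle_subset: "is_cycle V E C \<Longrightarrow> C \<subseteq> E"
  by (auto simp: is_cycle_def)

text \<open>The edge set enters \<open>is_cycle\<close> only through \<open>C \<subseteq> E\<close>.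
  Isolating this shows exactly which cycles disappear when an edge is removed.\<close>

lemma is_cycle_mono_iff:
  assumes "E \<subseteq> E'"
  shows "is_cycle V E C \<longleftrightarrow> is_cycle V E' C \<and> C \<subseteq> E"
proof -
  have sub: "{f i |i. i < n} \<subseteq> E \<longleftrightarrow> (\<forall>i<n. f i \<in> E)" for f :: "nat \<Rightarrow> 'a set" and n and E
    by blast
  have *: "is_cycle V E C \<longleftrightarrow> C \<subseteq> E \<and> (\<exists>vs. length vs \<ge> 3 \<and> distinct vs \<and> set vs \<subseteq> V \<and>
      C = {{vs ! i, vs ! ((i + 1) mod length vs)} | i. i < length vs})" for E
    unfolding is_cycle_def sub[symmetric] by blast
  show ?thesis unfolding *[of E] *[of E'] using subset_trans[of C E E', OF _ assms] by argo
qed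

lemma cycles_insert: "cycles V E = {C \<in> cycles V (insert e E). e \<notin> C}" if "e \<notin> E"
  using that is_cycle_mono_iff[of E "insert e E" V] is_cycle_subset[of V "insert e E"]
  unfolding cycles_def by blast

lemma finite_cycles: "finite E \<Longrightarrow> finite (cycles V E)"
  by (rule finite_subset[of _ "Pow E"]) (auto simp: cycles_def dest: is_cycle_subset)

text \<open>For length 2 this fails: both indices give the same edge.\<close>

lemma cyclic_edge_inj:
  assumes "distinct vs" "length vs \<ge> 3" "i < length vs" "j < length vs"
    and "{vs ! i, vs ! ((i + 1) mod length vs)} = {vs ! j, vs ! ((j + 1) mod length vs)}"
  shows "i = j"
proof (rule ccontr)
  assume "i \<noteq> j"
  have lt: "(i + 1) mod length vs < length vs" "(j + 1) mod length vs < length vs"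
    by (rule mod_less_divisor, use assms(3) in linarith)+
  from assms(5) have "vs ! i = vs ! ((j + 1) mod length vs) \<and> vs ! ((i + 1) mod length vs) = vs ! j"
    using \<open>i \<noteq> j\<close> nth_eq_iff_index_eq[OF assms(1,3,4)] unfolding doubleton_eq_iff by blast
  then have *: "i = (j + 1) mod length vs" "j = (i + 1) mod length vs"
    using nth_eq_iff_index_eq[OF assms(1,3) lt(2)] nth_eq_iff_index_eq[OF assms(1) lt(1) assms(4)] by auto
  have wrap: "(k + 1) mod length vs = k + 1 \<or> (k + 1) mod length vs = 0 \<and> k + 1 = length vs"
    if "k < length vs" for k
  proof (cases "k + 1 = length vs")
    case True
    then show ?thesis by (metis mod_self)
  next
    case False
    then have "k + 1 < length vs" using that by linarith
    then show ?thesis by (intro disjI1 mod_less)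
  qed
  have "i = j + 1 \<or> i = 0 \<and> j + 1 = length vs" "j = i + 1 \<or> j = 0 \<and> i + 1 = length vs"
    using wrap[OF assms(4), folded *(1)] wrap[OF assms(3), folded *(2)] .
  then show False using assms(2) by linarith
qed

lemma card_cycle_ge_3:
  assumes "is_cycle V E C"
  shows "card C \<ge> 3"
proof -
  obtain vs where vs: "length vs \<ge> 3" "distinct vs"
    "C = (\<lambda>i. {vs ! i, vs ! ((i + 1) mod length vs)}) ` {..<length vs}"
    using assms unfolding is_cycle_def by (auto simp: image_def Bex_def conj_commute)
  have "inj_on (\<lambda>i. {vs ! i, vs ! ((i + 1) mod length vs)}) {..<length vs}"
    using vs by (intro inj_onI cyclic_edge_inj) auto
  then show ?thesis using vs by (simp add: card_image)
qed

text \<open>The new edge closes up a path from \<open>u\<close> to \<open>v\<close>, which has at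
  least three vertices because \<open>u\<close> and \<open>v\<close> are distinct and not adjacent
  in \<open>E\<close>.\<close>

lemma cycle_through_inserted_edge:
  assumes "simple_graph V E" "u \<noteq> v" "{u, v} \<notin> E" "(u, v) \<in> reachable E"
  shows "\<exists>C\<in>cycles V (insert {u, v} E). {u, v} \<in> C"
proof -
  obtain p where p: "p \<noteq> []" "hd p = u" "last p = v" "distinct p"
    "\<And>i. Suc i < length p \<Longrightarrow> {p ! i, p ! Suc i} \<in> E"
    using reachable_imp_path[OF assms(4)] by blast
  let ?n = "length p"
  have ends: "p ! 0 = u" "p ! (?n - 1) = v" using p by (auto simp: hd_conv_nth last_conv_nth)
  have len: "?n \<ge> 3"
  proof (rule ccontr)
    assume "\<not> ?n \<ge> 3"
    moreover have "?n > 0" using p(1) by simp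
    ultimately consider "?n = 1" | "?n = 2" by linarith
    then show False using ends assms(2,3) p(5)[of 0] by cases (auto simp: numeral_2_eq_2)
  qed
  have edge: "{p ! i, p ! ((i + 1) mod ?n)} \<in> insert {u, v} E" if "i < ?n" for i
  proof (cases "Suc i < ?n")
    case True then show ?thesis using p(5) by simp
  next
    case False
    then have "i = ?n - 1" using that by simp
    moreover have "(?n - 1 + 1) mod ?n = 0" using p(1) by simp
    ultimately show ?thesis using ends by (simp only: insert_commute) simp
  qed
  have "set p \<subseteq> V"
  proof
    fix x assume "x \<in> set p"
    then obtain i where i: "i < ?n" "x = p ! i" by (auto simp: in_set_conv_nth)
    have "\<exists>e\<in>E. x \<in> e"
    proof (cases "Suc i < ?n")
      case True then show ?thesis using p(5) i by auto
    next
      case False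
      then have "Suc (i - 1) = i" using i len by linarith
      then have "{p ! (i - 1), p ! i} \<in> E" using p(5)[of "i - 1"] i(1) by simp
      then show ?thesis using i by auto
    qed
    then show "x \<in> V" using simple_graph_edge_subset[OF assms(1)] by blast
  qed
  let ?C = "{{p ! i, p ! ((i + 1) mod ?n)} | i. i < ?n}"
  have "is_cycle V (insert {u, v} E) ?C"
    unfolding is_cycle_def using len p(4) \<open>set p \<subseteq> V\<close> edge by (intro exI[of _ p]) simp
  then have cyc: "?C \<in> cycles V (insert {u, v} E)" unfolding cycles_def by (rule CollectI)
  have "{u, v} \<in> ?C"
    using ends p(1) by (intro CollectI exI[of _ "?n - 1"]) (simp add: insert_commute)
  then show ?thesis using cyc by (rule bexI)
qed

text \<open>Going around the cycle from one end of the new edge to the other uses only the remaining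
  edges; by \<open>cyclic_edge_inj\<close> none of them is \<open>{u, v}\<close> again.\<close>

lemma reachable_if_cycle_through:
  assumes "C \<in> cycles V (insert {u, v} E)" "{u, v} \<in> C"
  shows "(u, v) \<in> reachable E"
proof -
  obtain vs where vs: "length vs \<ge> 3" "distinct vs"
      "\<And>i. i < length vs \<Longrightarrow> {vs ! i, vs ! ((i + 1) mod length vs)} \<in> insert {u, v} E"
      "C = {{vs ! i, vs ! ((i + 1) mod length vs)} | i. i < length vs}"
    using assms(1) unfolding cycles_def is_cycle_def by auto
  let ?n = "length vs"
  obtain i where i: "i < ?n" "{u, v} = {vs ! i, vs ! ((i + 1) mod ?n)}"
    using assms(2) vs(4) by auto
  have walk: "(vs ! ((i + 1) mod ?n), vs ! ((i + 1 + k) mod ?n)) \<in> reachable E" if "k < ?n" for k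
    using that
  proof (induction k)
    case (Suc k)
    let ?j = "(i + 1 + k) mod ?n"
    have j: "?j < ?n" using vs(1) by (auto intro: mod_less_divisor)
    \<comment> \<open>Index \<open>i\<close> recurs only after a full turn, and \<open>k + 1\<close>
      steps are fewer than that.\<close>
    have "?j \<noteq> i" using i(1) Suc.prems by (auto simp: mod_if split: if_splits)
    then have "{vs ! ?j, vs ! ((?j + 1) mod ?n)} \<noteq> {u, v}"
      using cyclic_edge_inj[OF vs(2,1) j i(1)] i(2) by auto
    then have "adj E (vs ! ?j) (vs ! ((?j + 1) mod ?n))" using vs(3)[OF j] by (auto simp: adj_def)
    moreover have "(?j + 1) mod ?n = (i + 1 + Suc k) mod ?n" by (simp add: mod_Suc_eq)
    ultimately have "adj E (vs ! ?j) (vs ! ((i + 1 + Suc k) mod ?n))" by metis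
    then show ?case using Suc by (auto intro: rtrancl_into_rtrancl)
  qed simp
  have "i + 1 + (?n - 1) = i + ?n" using vs(1) by simp
  then have "(i + 1 + (?n - 1)) mod ?n = i" using i(1) by (metis mod_add_self2 mod_less)
  then have "(vs ! ((i + 1) mod ?n), vs ! i) \<in> reachable E"
    using walk[of "?n - 1"] i(1) by (metis One_nat_def Suc_pred lessI less_nat_zero_code not_gr_zero)
  then show ?thesis
    using i(2) equiv_reachable[of E] by (auto simp: doubleton_eq_iff equiv_def sym_def)
qed

text \<open>Adding an edge either merges two components or, when its ends are already joined by a path,
  closes a cycle; edge-disjointness makes that cycle the only new one.\<close>

lemma cyclomatic_number:
  assumes "finite V" "finite E" "simple_graph V E"
    and "\<And>C1 C2 e. C1 \<in> cycles V E \<Longrightarrow> C2 \<in> cycles V E \<Longrightarrow> e \<in> C1 \<Longrightarrow> e \<in> C2 \<Longrightarrow> C1 = C2"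
  shows "card E + card (V // reachable E) = card V + card (cycles V E)"
  using assms(2-4)
proof (induction E)
  case empty
  have "cycles V {} = {}" using card_cycle_ge_3 is_cycle_subset[of V "{}"]
    by (fastforce simp: cycles_def)
  moreover have "V // reachable {} = (\<lambda>x. {x}) ` V" by (auto simp: quotient_def adj_def)
  moreover have "card ((\<lambda>x. {x}) ` V) = card V" by (rule card_image) auto
  ultimately show ?case by simp
next
  case (insert e E)
  obtain u v where uv: "e = {u, v}" "u \<in> V" "v \<in> V" "u \<noteq> v"
    using insert.prems(1) by (auto simp: simple_graph_def)
  have sg: "simple_graph V E" using insert.prems(1) by (auto simp: simple_graph_def)
  have cyc: "cycles V E = {C \<in> cycles V (insert e E). e \<notin> C}"
    using cycles_insert insert.hyps(2) by blast
  have IH: "card E + card (V // reachable E) = card V + card (cycles V E)"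
    using insert.IH[OF sg] insert.prems(2) cyc by blast
  show ?case
  proof (cases "(u, v) \<in> reachable E")
    case True
    then obtain C where C: "C \<in> cycles V (insert e E)" "e \<in> C"
      using cycle_through_inserted_edge[OF sg uv(4)] insert.hyps(2) uv(1) by auto
    have "cycles V (insert e E) = insert C (cycles V E)"
      unfolding cyc using C insert.prems(2) by blast
    moreover have "C \<notin> cycles V E" using cyc C by blast
    moreover have "finite (cycles V E)" using finite_cycles insert.hyps(1) by blast
    moreover have "reachable (insert e E) = reachable E"
    proof -
      have "(v, u) \<in> reachable E"
        using True equiv_reachable[of E] by (auto simp: equiv_def sym_def)
      then have "(x, y) \<in> reachable (insert e E) \<longleftrightarrow> (x, y) \<in> reachable E" for x y
        using True unfolding uv(1) reachable_insert by (meson rtrancl_trans)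
      then show ?thesis by auto
    qed
    ultimately show ?thesis using IH insert.hyps by simp
  next
    case False
    then have "cycles V (insert e E) = cycles V E"
      using reachable_if_cycle_through[of _ V u v E] uv(1) cyc by blast
    then show ?thesis
      using card_components_insert[OF assms(1) uv(2,3) False] IH insert.hyps uv(1) by simp
  qed
qed

text \<open>A common edge would supply two common vertices. Unlike the cactus property,
  edge-disjointness is inherited by every smaller edge set.\<close>

lemma cactus_cycles_edge_disjoint:
  assumes "cactus V E" "C1 \<in> cycles V E" "C2 \<in> cycles V E" "e \<in> C1" "e \<in> C2"
  shows "C1 = C2"
proof (rule ccontr)
  assume "C1 \<noteq> C2"
  have sub: "C1 \<subseteq> E" "C2 \<subseteq> E"
    using assms(2,3) is_cycle_subset[of V E] unfolding cycles_def by blast+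
  have sg: "simple_graph V E" using assms(1) by (simp add: cactus_def)
  moreover have "e \<in> E" using sub(1) assms(4) by blast
  ultimately obtain u v where uv: "e = {u, v}" "u \<noteq> v"
    unfolding simple_graph_def by blast
  \<comment> \<open>Infinite sets have \<open>card\<close> 0, so two common vertices contradict the
    bound 1 only once the intersection is known to be finite.\<close>
  have "\<Union>C1 \<inter> \<Union>C2 \<subseteq> V"
    using simple_graph_edge_subset[OF sg] sub(1) by blast
  then have fin: "finite (\<Union>C1 \<inter> \<Union>C2)"
    using sg finite_subset unfolding simple_graph_def by blast
  have "card {u, v} \<le> card (\<Union>C1 \<inter> \<Union>C2)"
    using assms(4,5) uv fin by (intro card_mono) auto
  moreover have "card (\<Union>C1 \<inter> \<Union>C2) \<le> 1"
    using assms(1-3) \<open>C1 \<noteq> C2\<close> unfolding cactus_def by blast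
  ultimately show False using uv(2) by simp
qed

lemma card_edges_cactus:
  assumes "cactus V E"
  shows "card E + 1 = card V + card (cycles V E)"
proof -
  have sg: "simple_graph V E" and con: "connected_graph V E" using assms by (auto simp: cactus_def)
  have "reachable E `` {x} = V" if "x \<in> V" for x
  proof
    show "V \<subseteq> reachable E `` {x}" using con that by (auto simp: connected_graph_def)
    show "reachable E `` {x} \<subseteq> V"
    proof
      fix y assume "y \<in> reachable E `` {x}"
      then have "(x, y) \<in> reachable E" by simp
      then show "y \<in> V"
      proof (induction rule: rtrancl_induct)
        case base show ?case by (rule that)
      next
        case (step y z)
        then have "{y, z} \<in> E" by (simp add: adj_def)
        then show ?case using simple_graph_edge_subset[OF sg] by blast
      qed
    qed
  qed
  then have "V // reachable E = (\<lambda>_. V) ` V" by (auto simp: quotient_def)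
  also have "\<dots> = {V}" using con by (auto simp: connected_graph_def)
  finally have "card (V // reachable E) = 1" by simp
  moreover have "card E + card (V // reachable E) = card V + card (cycles V E)"
    using sg simple_graph_finite_edges[OF sg] cactus_cycles_edge_disjoint[OF assms]
    by (intro cyclomatic_number) (auto simp: simple_graph_def)
  ultimately show ?thesis by simp
qed

text \<open>The cycles are disjoint sets of at least three edges each. Combined with the edge count,
  this bounds the number of cycles by \<open>\<beta> - 1\<close>.\<close>

lemma three_cycles_le_edges:
  assumes "cactus V E"
  shows "3 * card (cycles V E) \<le> card E"
proof -
  have sg: "simple_graph V E" using assms by (simp add: cactus_def)
  note fin = simple_graph_finite_edges[OF sg]
  have "3 * card (cycles V E) \<le> (\<Sum>C\<in>cycles V E. card C)"
    using sum_bounded_below[of "cycles V E" 3 card] card_cycle_ge_3 by (force simp: cycles_def mult.commute)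
  also have "\<dots> = card (\<Union>(cycles V E))"
  proof (rule card_Union_disjoint[symmetric])
    show "pairwise disjnt (cycles V E)"
      unfolding pairwise_def disjnt_def using cactus_cycles_edge_disjoint[OF assms] by blast
    fix C assume "C \<in> cycles V E"
    then have "C \<subseteq> E" using is_cycle_subset[of V E] unfolding cycles_def by blast
    then show "finite C" using fin by (rule finite_subset)
  qed
  also have "\<dots> \<le> card E"
    using fin is_cycle_subset[of V E] by (intro card_mono Union_least) (auto simp: cycles_def)
  finally show ?thesis .
qed

section \<open>Estimates for Phi\<close>

text \<open>With k = 3 - sqrt 5, squaring turns the claim into 2 (a - k) (b - k) >= k^2. The left
  side is smallest at degrees 2 and 1, where equality holds because k is a root of k^2 = 6 k - 4. At
  a = b = 1 the estimate fails.\<close>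

lemma sqrt_sum_squares_le:
  fixes a b :: real
  assumes "a \<ge> 1" "b \<ge> 1" "a \<ge> 2 \<or> b \<ge> 2"
  shows "sqrt (a\<^sup>2 + b\<^sup>2) \<le> a + b - (3 - sqrt 5)"
proof -
  define k where "k = 3 - sqrt 5"
  have "sqrt 5 \<ge> 2" "sqrt 5 \<le> 3" by (simp_all add: real_le_rsqrt real_le_lsqrt)
  then have k: "0 \<le> k" "k \<le> 1" by (simp_all add: k_def)
  have kk: "k\<^sup>2 = 6 * k - 4" by (simp add: k_def power2_diff)
  have "(2 - k) * (1 - k) \<le> (a - k) * (b - k)"
    using assms(3)
  proof
    assume "a \<ge> 2"
    then show ?thesis using assms k by (intro mult_mono) auto
  next
    assume "b \<ge> 2"
    then have "(2 - k) * (1 - k) \<le> (b - k) * (a - k)" using assms k by (intro mult_mono) auto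
    then show ?thesis by (simp add: mult.commute)
  qed
  then have "a\<^sup>2 + b\<^sup>2 \<le> (a + b - k)\<^sup>2"
    using kk by (simp add: power2_eq_square algebra_simps)
  then show ?thesis using assms k unfolding k_def[symmetric] by (intro real_le_lsqrt) auto
qed

text \<open>The maximum of a convex function sits at the corner (D - 1, 3). When both values are at
  least 3, pushing one down to 3 with the sum fixed changes the sum of squares by 2 (a - 3) (b - 3)
  >= 0.\<close>

lemma sum_squares_le_balanced:
  fixes a b D :: real
  assumes "D \<ge> 4" "a \<le> D - 1" "b \<le> D - 1" "0 \<le> a" "0 \<le> b" "a + b \<le> D + 2"
  shows "a\<^sup>2 + b\<^sup>2 \<le> (D - 1)\<^sup>2 + 9"
proof -
  consider "a \<le> 3" | "b \<le> 3" | "a \<ge> 3" "b \<ge> 3" by linarith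
  then show ?thesis
  proof cases
    case 1
    then have "a\<^sup>2 \<le> 3\<^sup>2" "b\<^sup>2 \<le> (D - 1)\<^sup>2" using assms by (intro power_mono; simp)+
    then show ?thesis by simp
  next
    case 2
    then have "b\<^sup>2 \<le> 3\<^sup>2" "a\<^sup>2 \<le> (D - 1)\<^sup>2" using assms by (intro power_mono; simp)+
    then show ?thesis by simp
  next
    case 3
    have "(a + b - 3)\<^sup>2 \<le> (D - 1)\<^sup>2" using assms 3 by (intro power_mono) auto
    moreover have "(a - 3) * (b - 3) \<ge> 0" using 3 by simp
    then have "a\<^sup>2 + b\<^sup>2 \<le> (a + b - 3)\<^sup>2 + 9" by (simp add: power2_eq_square algebra_simps)
    ultimately show ?thesis by linarith
  qed
qed

text \<open>The left side adds the bound for the D - 1 unmatched edges to the one for the matching.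
  The difference to Phi is the saving on unmatched edges minus the overshoot of the linear estimate
  on \<open>Hstar\<close>.\<close>

lemma Phi_gt:
  assumes "\<beta> + t \<ge> 4" "t + 1 \<le> \<beta>"
  shows "(real \<beta> + real t - 1) * sqrt ((real \<beta> + real t - 1)\<^sup>2 + 9)
    + (4 * real \<beta> + 2 * real t - 2 - real \<beta> * (3 - sqrt 5)) < Phi \<beta> t"
proof -
  define D where "D = real \<beta> + real t"
  have b: "real \<beta> = D - real t" by (simp add: D_def)
  have D: "D \<ge> 4" "2 * real t \<le> D - 1" using assms unfolding D_def by linarith+
  have s5: "sqrt 5 \<le> 2.2361" by (rule real_le_lsqrt) (simp_all add: power2_eq_square)
  have s2: "sqrt 2 \<ge> 1.414" by (rule real_le_rsqrt) (simp add: power2_eq_square)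
  have sD: "sqrt (D\<^sup>2 + 1) \<ge> D" by (rule real_le_rsqrt) simp
  have rt: "real t * (1 + sqrt 5 - 2 * sqrt 2) \<le> real t * 0.4081"
    using s5 s2 by (intro mult_left_mono) auto
  \<comment> \<open>0.4081 and 0.2361 are upper bounds for 1 + sqrt 5 - 2 sqrt 2 and sqrt 5 - 2.\<close>
  have gap: "(D - 1) * (sqrt (D\<^sup>2 + 4) - sqrt ((D - 1)\<^sup>2 + 9)) > 0.4081 * real t + 0.2361"
  proof (cases "D = 4")
    \<comment> \<open>Integrality of \<open>t\<close> matters here: 2 t <= 3 alone would allow t =
      1.5, for which 3 (sqrt 20 - sqrt 18) is too small.\<close>
    case True
    have "sqrt 20 \<ge> 4.472" by (rule real_le_rsqrt) (simp add: power2_eq_square)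
    moreover have "sqrt 18 \<le> 4.243" by (rule real_le_lsqrt) (simp_all add: power2_eq_square)
    moreover have "real t \<le> 1"
    proof -
      have "t < 2" using True assms(2) unfolding D_def by linarith
      then show ?thesis by simp
    qed
    ultimately show ?thesis using True by simp
  next
    case False
    then have "\<beta> + t \<noteq> 4" unfolding D_def by linarith
    then have "\<beta> + t \<ge> 5" using assms(1) by linarith
    then have D5: "D \<ge> 5" unfolding D_def by linarith
    define s where "s = sqrt ((D - 1)\<^sup>2 + 9)"
    have s: "s \<ge> 0" "s\<^sup>2 = (D - 1)\<^sup>2 + 9" by (auto simp: s_def)
    have "s \<le> D + 2" unfolding s_def
      using D5 by (intro real_le_lsqrt) (auto simp: power2_eq_square algebra_simps)
    \<comment> \<open>For a constant x in place of 0.265, \<open>s \<le> D + 2\<close> reduces this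
      to x^2 + 2 x (D + 2) <= 2 D - 6, which at D = 5 allows x up to about 0.280. The comparison
      with t <= (D - 1) / 2 below needs x > 0.2631 there.\<close>
    then have "(s + 0.265)\<^sup>2 \<le> D\<^sup>2 + 4"
      using s(2) D5 by (simp add: power2_eq_square algebra_simps)
    then have "s + 0.265 \<le> sqrt (D\<^sup>2 + 4)" by (rule real_le_rsqrt)
    then have "(D - 1) * 0.265 \<le> (D - 1) * (sqrt (D\<^sup>2 + 4) - s)"
      using D5 by (intro mult_left_mono) auto
    moreover have "0.4081 * real t + 0.2361 < (D - 1) * 0.265" using D(2) D5 by simp
    ultimately show ?thesis unfolding s_def by (rule less_le_trans[rotated])
  qed
  have "Phi \<beta> t - ((D - 1) * sqrt ((D - 1)\<^sup>2 + 9)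
      + (4 * real \<beta> + 2 * real t - 2 - real \<beta> * (3 - sqrt 5)))
    = (D - 1) * (sqrt (D\<^sup>2 + 4) - sqrt ((D - 1)\<^sup>2 + 9))
      + (sqrt (D\<^sup>2 + 1) - D) - real t * (1 + sqrt 5 - 2 * sqrt 2) - (sqrt 5 - 2)"
    unfolding Phi_def D_def[symmetric] by (simp add: b algebra_simps)
  moreover have pos: "p + (q - D) - r - (c - 2) > 0"
    if "p > 0.4081 * real t + 0.2361" "q \<ge> D" "r \<le> real t * 0.4081" "c \<le> 2.2361" for p q r c
    using that by simp
  note pos[OF gap sD rt s5]
  ultimately show ?thesis unfolding D_def[symmetric] by linarith
qed

text \<open>For \<open>\<beta> + t = 3\<close> the unmatched edges join two vertices of degree 2, and the general bound
  \<open>sqrt (2\<^sup>2 + 3\<^sup>2)\<close> would be too weak.\<close>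

lemma Phi_gt_3:
  assumes "\<beta> + t = 3" "t + 1 \<le> \<beta>"
  shows "2 * sqrt 8 + (4 * real \<beta> + 2 * real t - 2 - real \<beta> * (3 - sqrt 5)) < Phi \<beta> t"
proof -
  have s8: "sqrt 8 = 2 * sqrt 2" using real_sqrt_mult[of 4 2] by simp
  have s2: "sqrt 2 \<le> 1.4143" by (rule real_le_lsqrt) (simp_all add: power2_eq_square)
  have s5: "sqrt 5 \<le> 2.2361" by (rule real_le_lsqrt) (simp_all add: power2_eq_square)
  have s13: "sqrt 13 \<ge> 3.6" by (rule real_le_rsqrt) (simp add: power2_eq_square)
  have s10: "sqrt 10 \<ge> 3.16" by (rule real_le_rsqrt) (simp add: power2_eq_square)
  consider "\<beta> = 3" "t = 0" | "\<beta> = 2" "t = 1" using assms by linarith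
  then show ?thesis
    by cases (use s8 s2 s5 s13 s10 in \<open>simp_all add: Phi_def\<close>)
qed

section \<open>Counting along a perfect matching\<close>

text \<open>The cactus structure is condensed into the edge count and
  \<open>t + 1 \<le> \<beta>\<close>; cycles do not appear from here on.\<close>

locale matched_graph =
  fixes V :: "'a set" and E M :: "'a set set" and \<beta> t :: nat
  assumes simple: "simple_graph V E" and connected: "connected_graph V E"
    and matching: "perfect_matching V E M"
    and card_V: "card V = 2 * \<beta>" and card_E: "card E + 1 = 2 * \<beta> + t"
    and t_less: "t + 1 \<le> \<beta>" and \<beta>_ge_2: "\<beta> \<ge> 2"
begin

abbreviation "d \<equiv> degree E"

definition star where "star v = {e \<in> E. v \<in> e}"

lemma card_star: "card (star v) = d v"
  by (simp add: star_def degree_def)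

lemma finite_V: "finite V" and finite_E: "finite E"
  using simple simple_graph_finite_edges by (auto simp: simple_graph_def)

lemma finite_star: "finite (star v)"
  using finite_E by (simp add: star_def)

lemma edgeE:
  assumes "e \<in> E"
  obtains u v where "e = {u, v}" "u \<in> V" "v \<in> V" "u \<noteq> v"
  using simple assms unfolding simple_graph_def by meson

lemma M_subset: "e \<in> M \<Longrightarrow> e \<in> E"
  using matching unfolding perfect_matching_def by (meson subsetD)

lemma finite_M: "finite M"
  using finite_E M_subset by (meson finite_subset subsetI)

lemma matching_unique: "v \<in> V \<Longrightarrow> e \<in> M \<Longrightarrow> e' \<in> M \<Longrightarrow> v \<in> e \<Longrightarrow> v \<in> e' \<Longrightarrow> e = e'"
  using matching unfolding perfect_matching_def by metis

lemma matched:
  assumes "v \<in> V"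
  obtains e where "e \<in> M" "v \<in> e"
  using matching assms unfolding perfect_matching_def by metis

lemma edge_subset: "e \<in> E \<Longrightarrow> e \<subseteq> V"
  using simple_graph_edge_subset[OF simple] .

lemma card_edge: "e \<in> E \<Longrightarrow> card e = 2"
  by (erule edgeE) simp

lemma finite_edge: "e \<in> E \<Longrightarrow> finite e"
  by (erule edgeE) simp

lemma Union_M: "\<Union>M = V"
  using edge_subset M_subset matched by (intro equalityI subsetI) (metis UnionE subsetD, metis UnionI)

text \<open>The matching edges partition \<open>V\<close>. This turns the degree sum into a sum over
  the edges to which the linear estimate is applied.\<close>

lemma sum_over_M: "(\<Sum>e\<in>M. \<Sum>v\<in>e. f v) = sum f V" for f :: "'a \<Rightarrow> nat"
proof -
  have "sum f (\<Union>M) = (\<Sum>e\<in>M. \<Sum>v\<in>e. f v)"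
  proof (subst sum.Union_disjoint)
    show "\<forall>e\<in>M. finite e" using finite_edge M_subset by simp
    show "\<forall>e\<in>M. \<forall>e'\<in>M. e \<noteq> e' \<longrightarrow> e \<inter> e' = {}"
      using matching_unique Union_M by (metis UnionI disjoint_iff)
  qed simp
  then show ?thesis by (simp add: Union_M)
qed

lemma card_M: "card M = \<beta>"
proof -
  have "(\<Sum>e\<in>M. \<Sum>v\<in>e. 1::nat) = (\<Sum>e\<in>M. 2)"
    using card_edge M_subset by (intro sum.cong) auto
  then show ?thesis using sum_over_M[of "\<lambda>_. 1"] card_V by simp
qed

lemma sum_degrees_M: "(\<Sum>e\<in>M. \<Sum>v\<in>e. d v) + 2 = 4 * \<beta> + 2 * t"
proof -
  have "(\<Sum>v\<in>V. card {e \<in> E. v \<in> e}) = (\<Sum>e\<in>E. 2)"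
  proof (rule sum_multicount_gen[OF finite_V finite_E], intro ballI)
    fix e assume e: "e \<in> E"
    then have "{v \<in> V. v \<in> e} = e" using edge_subset by auto
    then show "card {v \<in> V. v \<in> e} = 2" using card_edge[OF e] by simp
  qed
  then have "sum d V = 2 * card E" by (simp add: degree_def)
  then show ?thesis using sum_over_M[of d] card_E by linarith
qed

lemma degree_ge_1:
  assumes "v \<in> V" shows "d v \<ge> 1"
proof -
  obtain e where "e \<in> M" "v \<in> e" using matched assms by blast
  then have "e \<in> star v" using M_subset by (simp add: star_def)
  then have "card (star v) > 0" using finite_star by (auto simp: card_gt_0_iff)
  then show ?thesis by (simp add: card_star)
qed

lemma degree_ge_2:
  assumes "e \<in> E" "e' \<in> E" "e \<noteq> e'" "v \<in> e" "v \<in> e'"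
  shows "d v \<ge> 2"
proof -
  have "card {e, e'} \<le> card (star v)"
    using assms by (intro card_mono finite_star) (simp add: star_def)
  then show ?thesis using assms(3) by (simp add: card_star)
qed

lemma degree_ge_2_unmatched:
  assumes "e \<in> E" "e \<notin> M" "v \<in> e"
  shows "d v \<ge> 2"
proof -
  have "v \<in> V" using assms edge_subset by blast
  then obtain e' where "e' \<in> M" "v \<in> e'" using matched by blast
  then show ?thesis using assms degree_ge_2[of e e' v] M_subset by metis
qed

text \<open>The two stars share only the edge \<open>{u, v}\<close>, so their union has d u + d v -
  1 edges. It contains one matching edge if \<open>{u, v}\<close> is matched and at most two
  otherwise; the other matching edges are additional, and all must fit into
  \<open>E\<close>.\<close>

lemma degree_sum_le:
  assumes "{u, v} \<in> E" "u \<noteq> v"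
  shows "d u + d v \<le> \<beta> + t + (if {u, v} \<in> M then 1 else 2)"
proof -
  let ?X = "star u \<union> star v"
  have uv: "u \<in> V" "v \<in> V" using assms edge_subset by auto
  have "star u \<inter> star v = {{u, v}}"
  proof (intro equalityI subsetI)
    fix e assume "e \<in> star u \<inter> star v"
    then have e: "e \<in> E" "u \<in> e" "v \<in> e" by (auto simp: star_def)
    then obtain a b where "e = {a, b}" using edgeE by metis
    then show "e \<in> {{u, v}}" using e assms(2) by auto
  qed (use assms in \<open>auto simp: star_def\<close>)
  then have X: "card ?X + 1 = d u + d v"
    using card_Un_Int[OF finite_star finite_star, of u v] by (simp add: card_star)
  obtain eu ev where eu: "eu \<in> M" "u \<in> eu" and ev: "ev \<in> M" "v \<in> ev"
    using matched uv by metis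
  have "M \<inter> ?X \<subseteq> {eu, ev}"
  proof
    fix e assume "e \<in> M \<inter> ?X"
    then have "e \<in> M" "u \<in> e \<or> v \<in> e" by (auto simp: star_def)
    then show "e \<in> {eu, ev}" using matching_unique uv eu ev by blast
  qed
  then have "card (M \<inter> ?X) \<le> card {eu, ev}" by (intro card_mono) auto
  also have "\<dots> \<le> (if {u, v} \<in> M then 1 else 2)"
  proof (cases "{u, v} \<in> M")
    case True
    then have "eu = {u, v}" "ev = {u, v}" using matching_unique uv eu ev by blast+
    then show ?thesis by simp
  next
    case False
    then show ?thesis using card_insert_le_m1[of 2 "{ev}" eu] by simp
  qed
  finally have "card (M \<inter> ?X) \<le> (if {u, v} \<in> M then 1 else 2)" .
  moreover have "card (?X \<union> M) + card (M \<inter> ?X) = card ?X + card M"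
    using card_Un_Int[of ?X M] finite_star finite_M by (simp add: Int_commute)
  moreover have "card (?X \<union> M) \<le> card E"
    using M_subset by (intro card_mono finite_E) (auto simp: star_def)
  ultimately show ?thesis using X card_E card_M by linarith
qed

text \<open>The matched partner of \<open>v\<close> has degree at least 1, which takes one off the
  bound for the matched pair.\<close>

lemma degree_le:
  assumes "v \<in> V" shows "d v \<le> \<beta> + t"
proof -
  obtain e where e: "e \<in> M" "v \<in> e" using matched assms by blast
  then obtain a b where ab: "e = {a, b}" "a \<in> V" "b \<in> V" "a \<noteq> b" using M_subset edgeE by metis
  then have "d a + d b \<le> \<beta> + t + 1" using degree_sum_le[of a b] M_subset e by simp
  moreover have "v = a \<or> v = b" using e ab by simp
  ultimately show ?thesis using degree_ge_1[of a] degree_ge_1[of b] ab by auto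
qed

text \<open>The form in which connectedness is used: a matching edge cannot be a component by
  itself.\<close>

lemma edge_leaving:
  assumes "x \<in> S" "x \<in> V" "y \<in> V" "y \<notin> S"
  obtains a b where "a \<in> S" "b \<notin> S" "{a, b} \<in> E"
proof (rule ccontr)
  assume "\<not> thesis"
  then have closed: "\<And>a b. a \<in> S \<Longrightarrow> {a, b} \<in> E \<Longrightarrow> b \<in> S" using that by metis
  have "(x, y) \<in> reachable E" using connected assms by (simp add: connected_graph_def)
  then have "y \<in> S"
    by (induction rule: rtrancl_induct) (use assms(1) closed in \<open>auto simp: adj_def\<close>)
  then show False using assms(4) by simp
qed

text \<open>There are at least four vertices, so some edge leaves \<open>{u, v}\<close>. This rules
  out the pair (1, 1), where the linear estimate fails.\<close>

lemma matched_edge_degree_ge_2: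
  assumes "{u, v} \<in> M" "u \<noteq> v"
  shows "d u \<ge> 2 \<or> d v \<ge> 2"
proof -
  have uv: "u \<in> V" "v \<in> V" using edge_subset[OF M_subset[OF assms(1)]] by auto
  have "card {u, v} < card V" using card_V \<beta>_ge_2 assms(2) by simp
  then have "\<not> V \<subseteq> {u, v}" using card_mono[of "{u, v}" V] by force
  then obtain y where "y \<in> V" "y \<notin> {u, v}" by blast
  then obtain a b where ab: "a \<in> {u, v}" "b \<notin> {u, v}" "{a, b} \<in> E"
    using edge_leaving[of u "{u, v}" y] uv by auto
  then have "{a, b} \<noteq> {u, v}" by auto
  then have "d a \<ge> 2" using degree_ge_2[of "{a, b}" "{u, v}" a] ab M_subset assms by auto
  then show ?thesis using ab(1) by auto
qed

section \<open>Edge weights when no vertex has degree D\<close>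

definition weight :: "'a set \<Rightarrow> real" where
  "weight e = sqrt (\<Sum>v\<in>e. (real (d v))\<^sup>2)"

lemma weight_edge: "u \<noteq> v \<Longrightarrow> weight {u, v} = sqrt ((real (d u))\<^sup>2 + (real (d v))\<^sup>2)"
  by (simp add: weight_def)

lemma sombor_split: "sombor E = (\<Sum>e\<in>E - M. weight e) + (\<Sum>e\<in>M. weight e)"
proof -
  have "M \<subseteq> E" using M_subset by blast
  then show ?thesis
    unfolding sombor_def weight_def by (intro sum.subset_diff finite_E)
qed

lemma sum_weight_M:
  "(\<Sum>e\<in>M. weight e) \<le> 4 * real \<beta> + 2 * real t - 2 - real \<beta> * (3 - sqrt 5)"
proof -
  have "(\<Sum>e\<in>M. weight e) \<le> (\<Sum>e\<in>M. real (\<Sum>v\<in>e. d v) - (3 - sqrt 5))"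
  proof (rule sum_mono)
    fix e assume e: "e \<in> M"
    obtain u v where uv: "e = {u, v}" "u \<in> V" "v \<in> V" "u \<noteq> v" using edgeE M_subset e by metis
    have "real (d u) \<ge> 1" "real (d v) \<ge> 1" "real (d u) \<ge> 2 \<or> real (d v) \<ge> 2"
      using degree_ge_1 uv matched_edge_degree_ge_2[of u v] e by force+
    then show "weight e \<le> real (\<Sum>v\<in>e. d v) - (3 - sqrt 5)"
      using sqrt_sum_squares_le uv(1,4) by (simp add: weight_edge)
  qed
  also have "\<dots> = real (\<Sum>e\<in>M. \<Sum>v\<in>e. d v) - real \<beta> * (3 - sqrt 5)"
    by (simp add: sum_subtractf card_M)
  also have "real (\<Sum>e\<in>M. \<Sum>v\<in>e. d v) = 4 * real \<beta> + 2 * real t - 2"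
    using arg_cong[OF sum_degrees_M, of real] by simp
  finally show ?thesis .
qed

lemma card_E_minus_M: "real (card (E - M)) = real \<beta> + real t - 1"
proof -
  have "card (E - M) = card E - card M"
    using M_subset finite_M by (intro card_Diff_subset) auto
  then have "card (E - M) + 1 = \<beta> + t" using card_E card_M \<beta>_ge_2 by linarith
  then show ?thesis by linarith
qed

lemma sombor_less:
  assumes less: "\<And>v. v \<in> V \<Longrightarrow> d v < \<beta> + t"
  shows "sombor E < Phi \<beta> t"
proof -
  have unmatched: "\<exists>u v. e = {u, v} \<and> u \<noteq> v \<and> 2 \<le> d u \<and> 2 \<le> d v \<and> d u + 1 \<le> \<beta> + t
      \<and> d v + 1 \<le> \<beta> + t \<and> d u + d v \<le> \<beta> + t + 2" if e: "e \<in> E - M" for e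
  proof -
    obtain u v where uv: "e = {u, v}" "u \<in> V" "v \<in> V" "u \<noteq> v" using edgeE e by blast
    then have "d u \<ge> 2" "d v \<ge> 2" "d u + d v \<le> \<beta> + t + 2"
      using degree_ge_2_unmatched[of e] degree_sum_le[of u v] e by auto
    then show ?thesis
      using uv less[of u] less[of v] by (intro exI[of _ u] exI[of _ v]) simp
  qed
  \<comment> \<open>For D = 2 the hypothesis would leave only degrees below 2, but a matched edge
    has an end of degree at least 2.\<close>
  obtain e where "e \<in> M" using card_M \<beta>_ge_2 by fastforce
  then obtain u v where "{u, v} \<in> M" "u \<in> V" "v \<in> V" "u \<noteq> v" using edgeE M_subset by metis
  then have "\<beta> + t \<noteq> 2" using matched_edge_degree_ge_2[of u v] less[of u] less[of v] by auto
  then consider "\<beta> + t = 3" | "\<beta> + t \<ge> 4" using \<beta>_ge_2 by linarith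
  then show ?thesis
  proof cases
    case 1
    have "weight e \<le> sqrt 8" if e: "e \<in> E - M" for e
    proof -
      obtain u v where "e = {u, v}" "u \<noteq> v" "d u = 2" "d v = 2"
        using unmatched[OF e] 1 by force
      then show ?thesis by (simp add: weight_edge)
    qed
    then have "(\<Sum>e\<in>E - M. weight e) \<le> real (card (E - M)) * sqrt 8"
      by (rule sum_bounded_above)
    moreover have "real \<beta> + real t = 3" using 1 by linarith
    ultimately show ?thesis
      using sum_weight_M Phi_gt_3[OF 1 t_less] by (simp add: card_E_minus_M sombor_split)
  next
    case 2
    have "weight e \<le> sqrt ((real \<beta> + real t - 1)\<^sup>2 + 9)" if e: "e \<in> E - M" for e
    proof -
      obtain u v where uv: "e = {u, v}" "u \<noteq> v" "d u + 1 \<le> \<beta> + t" "d v + 1 \<le> \<beta> + t"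
        "d u + d v \<le> \<beta> + t + 2"
        using unmatched[OF e] by blast
      have "(real (d u))\<^sup>2 + (real (d v))\<^sup>2 \<le> (real \<beta> + real t - 1)\<^sup>2 + 9"
        using uv(3-5) 2 by (intro sum_squares_le_balanced) linarith+
      then show ?thesis using uv(1,2) by (simp add: weight_edge)
    qed
    then have "(\<Sum>e\<in>E - M. weight e) \<le> real (card (E - M)) * sqrt ((real \<beta> + real t - 1)\<^sup>2 + 9)"
      by (rule sum_bounded_above)
    then show ?thesis
      using sum_weight_M Phi_gt[OF 2 t_less] by (simp add: card_E_minus_M sombor_split)
  qed
qed

end

section \<open>A vertex of maximal degree\<close>

locale extremal_graph = matched_graph +
  fixes c assumes c: "c \<in> V" and d_c: "degree E c = \<beta> + t"
begin

definition m0 where "m0 = (THE e. e \<in> M \<and> c \<in> e)"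

lemma m0: "m0 \<in> M" "c \<in> m0"
proof -
  have "\<exists>!e. e \<in> M \<and> c \<in> e" using matching c by (simp add: perfect_matching_def)
  from theI'[OF this] show "m0 \<in> M" "c \<in> m0" by (simp_all add: m0_def)
qed

text \<open>This vertex becomes the pendant neighbour of the center.\<close>

definition p where "p = (SOME v. m0 = {c, v})"

lemma m0_eq: "m0 = {c, p}" and p: "p \<in> V" "p \<noteq> c"
proof -
  obtain a b where ab: "m0 = {a, b}" "a \<in> V" "b \<in> V" "a \<noteq> b" using edgeE M_subset m0 by metis
  then have "\<exists>v. m0 = {c, v}" using m0 by auto
  then show "m0 = {c, p}" unfolding p_def by (rule someI_ex)
  then show "p \<in> V" "p \<noteq> c" using ab by (auto simp: doubleton_eq_iff)
qed

definition N where "N = {v. {c, v} \<in> E}"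
text \<open>These turn out to be precisely the edges not at the center.\<close>

definition A where "A = M - {m0}"

lemma N_subset: "N \<subseteq> V - {c}"
proof
  fix v assume "v \<in> N"
  then have e: "{c, v} \<in> E" by (simp add: N_def)
  then show "v \<in> V - {c}" using edge_subset[OF e] card_edge[OF e] by auto
qed

lemma finite_N: "finite N"
  using N_subset finite_V finite_subset by fast

lemma star_c: "star c = (\<lambda>v. {c, v}) ` N"
proof (intro equalityI subsetI)
  fix e assume "e \<in> star c"
  then have e: "e \<in> E" "c \<in> e" by (auto simp: star_def)
  then obtain u v where uv: "e = {u, v}" using edgeE by metis
  then consider "e = {c, v}" | "e = {c, u}" using e(2) by auto
  then show "e \<in> (\<lambda>v. {c, v}) ` N" using e(1) by cases (auto simp: N_def)
qed (auto simp: N_def star_def)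

lemma inj_c: "inj_on (\<lambda>v. {c, v}) X"
  by (auto simp: inj_on_def doubleton_eq_iff)

lemma card_N: "card N = \<beta> + t"
  using card_star[of c] d_c card_image[OF inj_c, of N] by (simp add: star_c)

lemma finite_A: "finite A" and card_A: "card A + 1 = \<beta>"
  using finite_M card_M m0(1) \<beta>_ge_2 by (simp_all add: A_def)

lemma A_subset: "e \<in> A \<Longrightarrow> e \<in> M" "e \<in> A \<Longrightarrow> e \<in> E"
  using M_subset by (auto simp: A_def)

lemma A_avoids: "e \<in> A \<Longrightarrow> c \<notin> e" "e \<in> A \<Longrightarrow> p \<notin> e"
  using matching_unique[OF c _ m0(1)] matching_unique[OF p(1) _ m0(1)] m0(2) m0_eq
  by (auto simp: A_def)

lemma star_disjoint_A: "star c \<inter> A = {}"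
  using A_avoids by (auto simp: star_def)

text \<open>The \<open>\<beta> + t\<close> edges at \<open>c\<close> and the
  \<open>\<beta> - 1\<close> edges of \<open>A\<close> are disjoint and already number
  \<open>card E\<close>.\<close>

lemma E_eq: "E = star c \<union> A"
proof -
  have sub: "star c \<union> A \<subseteq> E" using A_subset by (auto simp: star_def)
  have "card (star c \<union> A) = card E"
    using card_Un_disjoint[OF finite_star finite_A star_disjoint_A] card_star[of c] d_c card_A card_E
    by linarith
  then show ?thesis using card_subset_eq[OF finite_E sub] by simp
qed

lemma p_in_N: "p \<in> N"
  using m0_eq M_subset[OF m0(1)] by (simp add: N_def)

lemma covered:
  assumes "v \<in> V" "v \<noteq> c" "v \<noteq> p"
  obtains e where "e \<in> A" "v \<in> e"
proof -
  obtain e where e: "e \<in> M" "v \<in> e" using matched assms(1) by blast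
  then have "e \<noteq> m0" using assms m0_eq by auto
  then show thesis using that e by (simp add: A_def)
qed

text \<open>Some edge leaves \<open>e\<close>; it shares a vertex with \<open>e\<close>, so it is
  unmatched and must end at \<open>c\<close>.\<close>

lemma A_meets_N:
  assumes "e \<in> A" shows "\<exists>v\<in>e. v \<in> N"
proof -
  obtain u v where uv: "e = {u, v}" "u \<in> V" using edgeE A_subset(2)[OF assms] by metis
  obtain a b where ab: "a \<in> e" "b \<notin> e" "{a, b} \<in> E"
    using edge_leaving[of u e c] uv c A_avoids(1)[OF assms] by auto
  have "{a, b} \<notin> A"
  proof
    assume "{a, b} \<in> A"
    then have "{a, b} = e"
      using matching_unique[of a "{a, b}" e] A_subset assms ab edge_subset[OF ab(3)] by auto
    then show False using ab(2) by auto
  qed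
  then have "{a, b} \<in> star c" using ab(3) E_eq by auto
  then have "c = b" using A_avoids(1)[OF assms] ab(1) by (auto simp: star_def)
  then have "a \<in> N" using ab(3) unfolding N_def by (simp add: insert_commute)
  then show ?thesis using ab(1) by blast
qed

text \<open>These edges close triangles with \<open>c\<close>; the other edges of \<open>A\<close>
  are the outer edges of the paths.\<close>

definition T where "T = {e \<in> A. e \<subseteq> N}"

lemma finite_T: "finite T" and T_subset: "T \<subseteq> A"
  using finite_A by (auto simp: T_def)

lemma card_Int_N:
  assumes "e \<in> A" shows "card (e \<inter> N) = (if e \<in> T then 2 else 1)"
proof -
  obtain u v where uv: "e = {u, v}" "u \<noteq> v" using edgeE A_subset(2)[OF assms] by metis
  then have "u \<in> N \<or> v \<in> N" using A_meets_N[OF assms] by auto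
  then show ?thesis
    using uv assms by (cases "u \<in> N"; cases "v \<in> N") (auto simp: T_def)
qed

text \<open>Apart from \<open>p\<close>, the neighbours of \<open>c\<close> lie on edges of
  \<open>A\<close>, two on each edge of \<open>T\<close> and one on each other. Hence \<beta> + t =
  1 + (\<beta> - 1) + card T.\<close>

lemma card_T: "card T = t"
proof -
  have "N = insert p (\<Union>e\<in>A. e \<inter> N)"
  proof (intro equalityI subsetI)
    fix v assume v: "v \<in> N"
    then show "v \<in> insert p (\<Union>e\<in>A. e \<inter> N)" using covered[of v] N_subset by blast
  qed (use p_in_N in auto)
  moreover have "p \<notin> (\<Union>e\<in>A. e \<inter> N)" using A_avoids(2) by auto
  moreover have "finite (\<Union>e\<in>A. e \<inter> N)" using finite_A finite_N by auto
  ultimately have "card N = Suc (card (\<Union>e\<in>A. e \<inter> N))" by (metis card_insert_disjoint)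
  also have "card (\<Union>e\<in>A. e \<inter> N) = (\<Sum>e\<in>A. card (e \<inter> N))"
  proof (rule card_UN_disjoint[OF finite_A])
    show "\<forall>e\<in>A. finite (e \<inter> N)" using finite_N by simp
    show "\<forall>e\<in>A. \<forall>e'\<in>A. e \<noteq> e' \<longrightarrow> e \<inter> N \<inter> (e' \<inter> N) = {}"
      using matching_unique A_subset edge_subset by blast
  qed
  also have "\<dots> = (\<Sum>e\<in>A. 1 + (if e \<in> T then 1 else 0))"
    using card_Int_N by (intro sum.cong) auto
  also have "\<dots> = (\<Sum>e\<in>A. 1) + (\<Sum>e\<in>A. if e \<in> T then 1 else 0)" by (rule sum.distrib)
  also have "(\<Sum>e\<in>A. if e \<in> T then 1 else 0) = card T"
    using T_subset finite_A by (simp add: sum.If_cases Int_absorb1)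
  finally show ?thesis using card_N card_A by simp
qed

lemma degree_in_A:
  assumes "e \<in> A" "v \<in> e" shows "d v = (if v \<in> N then 2 else 1)"
proof -
  have "v \<noteq> c" using A_avoids assms by blast
  have "star v = (if v \<in> N then {e, {c, v}} else {e})"
  proof -
    have "star v \<inter> A = {e}"
      using assms A_subset matching_unique edge_subset unfolding star_def by blast
    moreover have "star v \<inter> star c = (if v \<in> N then {{c, v}} else {})"
      unfolding star_c using \<open>v \<noteq> c\<close> by (auto simp: star_def N_def)
    moreover have "star v = (star v \<inter> A) \<union> (star v \<inter> star c)"
      using E_eq unfolding star_def by blast
    ultimately show ?thesis by auto
  qed
  moreover have "e \<noteq> {c, v}" using A_avoids(1)[OF assms(1)] by auto
  ultimately show ?thesis using card_star[of v] by (auto split: if_splits)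
qed

lemma degree_p: "d p = 1"
proof -
  have "star p = {{c, p}}"
  proof (intro equalityI subsetI)
    fix e assume e: "e \<in> star p"
    then have "e \<notin> A" using A_avoids by (auto simp: star_def)
    then have "e \<in> star c" using e E_eq by (auto simp: star_def)
    then obtain v where "e = {c, v}" unfolding star_c by blast
    then show "e \<in> {{c, p}}" using e p(2) by (simp add: star_def)
  qed (use p_in_N in \<open>auto simp: star_def N_def\<close>)
  then show ?thesis using card_star[of p] by simp
qed

lemma sombor_eq: "sombor E = Phi \<beta> t"
proof -
  let ?D = "real \<beta> + real t"
  have "sombor E = (\<Sum>e\<in>star c. weight e) + (\<Sum>e\<in>A. weight e)"
  proof -
    have "sombor E = (\<Sum>e\<in>E. weight e)" by (simp add: sombor_def weight_def)
    also have "\<dots> = (\<Sum>e\<in>star c \<union> A. weight e)" using E_eq by simp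
    finally show ?thesis
      using sum.union_disjoint[OF finite_star finite_A star_disjoint_A] by simp
  qed
  also have "(\<Sum>e\<in>A. weight e) = (\<Sum>e\<in>A. if e \<in> T then 2 * sqrt 2 else sqrt 5)"
  proof (rule sum.cong)
    fix e assume e: "e \<in> A"
    obtain u v where uv: "e = {u, v}" "u \<noteq> v" using edgeE A_subset(2)[OF e] by metis
    have "d u = (if u \<in> N then 2 else 1)" "d v = (if v \<in> N then 2 else 1)"
      using degree_in_A[OF e] uv(1) by simp_all
    moreover have "u \<in> N \<or> v \<in> N" using A_meets_N[OF e] uv(1) by auto
    moreover have "e \<in> T \<longleftrightarrow> u \<in> N \<and> v \<in> N" using e uv(1) by (simp add: T_def)
    moreover have "sqrt 8 = 2 * sqrt 2" using real_sqrt_mult[of 4 2] by simp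
    ultimately show "weight e = (if e \<in> T then 2 * sqrt 2 else sqrt 5)"
      by (auto simp: uv(1) weight_edge[OF uv(2)])
  qed simp
  also have "\<dots> = real (card T) * (2 * sqrt 2) + real (card (A - T)) * sqrt 5"
    using T_subset finite_A by (simp add: sum.If_cases Int_absorb1 Diff_eq)
  also have "real (card (A - T)) = real \<beta> - real t - 1"
    using card_Diff_subset[OF finite_T T_subset] card_A card_T t_less by linarith
  also have "(\<Sum>e\<in>star c. weight e) = (\<Sum>v\<in>N. weight {c, v})"
    unfolding star_c by (simp add: sum.reindex[OF inj_c])
  also have "\<dots> = weight {c, p} + (\<Sum>v\<in>N - {p}. weight {c, v})"
    by (rule sum.remove[OF finite_N p_in_N])
  also have "weight {c, p} = sqrt (?D\<^sup>2 + 1)"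
    using p(2) d_c degree_p by (simp add: weight_edge)
  also have "(\<Sum>v\<in>N - {p}. weight {c, v}) = (\<Sum>v\<in>N - {p}. sqrt (?D\<^sup>2 + 4))"
  proof (rule sum.cong)
    fix v assume v: "v \<in> N - {p}"
    then obtain e where "e \<in> A" "v \<in> e" using covered[of v] N_subset by blast
    then have "d v = 2" using degree_in_A v by simp
    moreover have "v \<noteq> c" using v N_subset by blast
    ultimately show "weight {c, v} = sqrt (?D\<^sup>2 + 4)" using d_c by (simp add: weight_edge)
  qed simp
  also have "\<dots> = (?D - 1) * sqrt (?D\<^sup>2 + 4)"
  proof -
    have "real (card (N - {p})) = ?D - 1"
      using card_N p_in_N \<beta>_ge_2 by (simp add: finite_N of_nat_diff)
    then show ?thesis by simp
  qed
  finally show ?thesis by (simp add: Phi_def card_T algebra_simps)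
qed

end

section \<open>Isomorphism with the extremal graph\<close>

lemma Hstar_E_image:
  "Hstar_E \<beta> t = (\<lambda>i. {0, 2*i+1}) ` {..<t} \<union> (\<lambda>i. {0, 2*i+2}) ` {..<t}
     \<union> (\<lambda>i. {2*i+1, 2*i+2}) ` {..<t} \<union> {{0, 2*t+1}}
     \<union> (\<lambda>j. {0, 2*t+2+2*j}) ` {..<\<beta>-t-1} \<union> (\<lambda>j. {2*t+2+2*j, 2*t+3+2*j}) ` {..<\<beta>-t-1}"
  unfolding Hstar_E_def by (simp only: setcompr_eq_image lessThan_def)

lemma Hstar_E_subset:
  assumes "t + 1 \<le> \<beta>" "e \<in> Hstar_E \<beta> t"
  shows "e \<subseteq> Hstar_V \<beta> t"
  using assms unfolding Hstar_E_image Hstar_V_def by auto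

text \<open>A numbering runs from \<open>Hstar\<close> to the graph, opposite to the map in
  \<open>graph_iso\<close>. Injectivity on vertex sets gives both directions of the edge condition
  for the inverse.\<close>

lemma graph_iso_if_image:
  assumes g: "bij_betw g V' V" and E: "E = (\<lambda>e. g ` e) ` E'" and sub: "\<And>e. e \<in> E' \<Longrightarrow> e \<subseteq> V'"
  shows "graph_iso V E V' E'"
proof -
  let ?f = "inv_into V' g"
  have "{u, v} \<in> E \<longleftrightarrow> {?f u, ?f v} \<in> E'" if "u \<in> V" "v \<in> V" for u v
  proof -
    have "?f u \<in> V'" "?f v \<in> V'" "g (?f u) = u" "g (?f v) = v"
      using that g by (auto simp: bij_betw_def inv_into_into f_inv_into_f)
    moreover have "inj_on (\<lambda>e. g ` e) (Pow V')"
      using g by (auto simp: bij_betw_def intro: inj_on_image_Pow)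
    then have "g ` {?f u, ?f v} \<in> (\<lambda>e. g ` e) ` E' \<longleftrightarrow> {?f u, ?f v} \<in> E'"
      by (rule inj_on_image_mem_iff) (use sub calculation in auto)
    ultimately show ?thesis by (simp add: E)
  qed
  then show ?thesis
    unfolding graph_iso_def using bij_betw_inv_into[OF g] by blast
qed

context extremal_graph
begin

lemma iso_Hstar: "graph_iso V E (Hstar_V \<beta> t) (Hstar_E \<beta> t)"
proof -
  define k where "k = \<beta> - t - 1"
  have \<beta>: "\<beta> = t + k + 1" using t_less by (simp add: k_def)
  have card_P: "card (A - T) = k"
    using card_Diff_subset[OF finite_T T_subset] card_A card_T \<beta> by linarith
  obtain hT where hT: "bij_betw hT {0..<t} T"
    using ex_bij_betw_nat_finite[OF finite_T] card_T by auto
  obtain hP where hP: "bij_betw hP {0..<k} (A - T)"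
    using ex_bij_betw_nat_finite[of "A - T"] finite_A card_P by auto
  \<comment> \<open>Each edge of \<open>A\<close> is oriented to start at a neighbour of
    \<open>c\<close>, so that on a path the first end is the middle vertex and the second the
    leaf.\<close>
  have "\<exists>z. e = {fst z, snd z} \<and> fst z \<in> N \<and> (snd z \<in> N \<longleftrightarrow> e \<in> T)" if e: "e \<in> A" for e
  proof -
    obtain u where u: "u \<in> e" "u \<in> N" using A_meets_N[OF e] by blast
    obtain a b where ab: "e = {a, b}" using edgeE A_subset(2)[OF e] by metis
    then obtain v where v: "e = {u, v}" using u(1) by (auto simp: insert_commute)
    then have "v \<in> N \<longleftrightarrow> e \<in> T" using u e by (simp add: T_def)
    then show ?thesis using u v by (intro exI[of _ "(u, v)"]) simp
  qed
  then obtain z where z: "\<And>e. e \<in> A \<Longrightarrow> e = {fst (z e), snd (z e)} \<and> fst (z e) \<in> N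
      \<and> (snd (z e) \<in> N \<longleftrightarrow> e \<in> T)"
    by metis
  define a b a' b' where "a i = fst (z (hT i))" and "b i = snd (z (hT i))"
    and "a' i = fst (z (hP i))" and "b' i = snd (z (hP i))" for i
  have T_eq: "T = (\<lambda>i. {a i, b i}) ` {..<t}"
  proof -
    have hTT: "hT i \<in> T" if "i < t" for i using hT that by (auto simp: bij_betw_def)
    have "T = hT ` {..<t}" using hT by (simp add: bij_betw_def atLeast0LessThan)
    also have "\<dots> = (\<lambda>i. {a i, b i}) ` {..<t}"
      using hTT z T_subset by (intro image_cong refl) (auto simp: a_def b_def)
    finally show ?thesis .
  qed
  have P_eq: "A - T = (\<lambda>i. {a' i, b' i}) ` {..<k}"
  proof -
    have hPP: "hP i \<in> A - T" if "i < k" for i using hP that by (auto simp: bij_betw_def)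
    have "A - T = hP ` {..<k}" using hP by (simp add: bij_betw_def atLeast0LessThan)
    also have "\<dots> = (\<lambda>i. {a' i, b' i}) ` {..<k}"
      using hPP z by (intro image_cong refl) (auto simp: a'_def b'_def)
    finally show ?thesis .
  qed
  have A_eq: "A = (\<lambda>i. {a i, b i}) ` {..<t} \<union> (\<lambda>i. {a' i, b' i}) ` {..<k}"
    unfolding T_eq[symmetric] P_eq[symmetric] using T_subset by blast
  have mem_N: "a i \<in> N" "b i \<in> N" if "i < t" for i
  proof -
    have "{a i, b i} \<in> T" using that by (simp add: T_eq)
    then have "{a i, b i} \<subseteq> N" by (simp add: T_def)
    then show "a i \<in> N" "b i \<in> N" by auto
  qed
  have mem_N': "a' i \<in> N" "b' i \<notin> N" if "i < k" for i
  proof -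
    have "hP i \<in> A - T" using hP that by (auto simp: bij_betw_def)
    then show "a' i \<in> N" "b' i \<notin> N" using z by (auto simp: a'_def b'_def)
  qed
  have N_eq: "N = insert p (a ` {..<t} \<union> b ` {..<t} \<union> a' ` {..<k})"
  proof (intro equalityI subsetI)
    fix v assume v: "v \<in> N"
    show "v \<in> insert p (a ` {..<t} \<union> b ` {..<t} \<union> a' ` {..<k})"
    proof (cases "v = p")
      case False
      then obtain e where "e \<in> A" "v \<in> e" using covered[of v] N_subset v by blast
      then consider i where "i < t" "v \<in> {a i, b i}" | i where "i < k" "v \<in> {a' i, b' i}"
        unfolding A_eq by blast
      then show ?thesis using mem_N'(2) v by cases auto
    qed simp
  qed (use mem_N mem_N' p_in_N in auto)
  \<comment> \<open>Follows the numbering of \<open>Hstar\<close>. Number 0 is caught first, so the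
    truncated subtraction in the argument of \<open>b\<close> is harmless.\<close>
  define g where "g n = (if n = 0 then c else if n = 2 * t + 1 then p
      else if n \<le> 2 * t then (if odd n then a (n div 2) else b (n div 2 - 1))
      else if even n then a' ((n - 2 * t - 2) div 2) else b' ((n - 2 * t - 3) div 2))" for n
  have g: "g 0 = c" "g (2 * t + 1) = p" "\<And>i. i < t \<Longrightarrow> g (2 * i + 1) = a i"
    "\<And>i. i < t \<Longrightarrow> g (2 * i + 2) = b i" "\<And>j. g (2 * t + 2 + 2 * j) = a' j"
    "\<And>j. g (2 * t + 3 + 2 * j) = b' j"
    by (auto simp: g_def)
  have E_image: "E = (\<lambda>e. g ` e) ` Hstar_E \<beta> t"
  proof -
    have "(\<lambda>e. g ` e) ` Hstar_E \<beta> t = (\<lambda>i. {c, a i}) ` {..<t} \<union> (\<lambda>i. {c, b i}) ` {..<t}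
        \<union> (\<lambda>i. {a i, b i}) ` {..<t} \<union> {{c, p}}
        \<union> (\<lambda>j. {c, a' j}) ` {..<k} \<union> (\<lambda>j. {a' j, b' j}) ` {..<k}"
      unfolding Hstar_E_image k_def[symmetric] image_Un image_image
      by (intro arg_cong2[of _ _ _ _ "(\<union>)"] image_cong refl)
        (simp_all only: image_insert image_empty g lessThan_iff)
    also have "\<dots> = star c \<union> A"
      unfolding star_c N_eq A_eq image_insert image_Un image_image by blast
    finally show ?thesis using E_eq by simp
  qed
  have sub: "V \<subseteq> g ` {0..<2 * \<beta>}"
  proof
    fix v assume v: "v \<in> V"
    consider "v = c" | "v = p" | "v \<noteq> c" "v \<noteq> p" by blast
    then have "\<exists>n<2 * \<beta>. g n = v"
    proof cases
      case 1 then show ?thesis using g(1) \<beta> by (intro exI[of _ 0]) simp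
    next
      case 2 then show ?thesis using g(2) \<beta> by (intro exI[of _ "2 * t + 1"]) simp
    next
      case 3
      then obtain e where "e \<in> A" "v \<in> e" using covered v by blast
      then consider i where "i < t" "v = a i" | i where "i < t" "v = b i"
        | i where "i < k" "v = a' i" | i where "i < k" "v = b' i"
        unfolding A_eq by blast
      then show ?thesis
      proof cases
        case (1 i) then show ?thesis using g(3) \<beta> by (intro exI[of _ "2 * i + 1"]) simp
      next
        case (2 i) then show ?thesis using g(4) \<beta> by (intro exI[of _ "2 * i + 2"]) simp
      next
        case (3 i) then show ?thesis using g(5)[of i] \<beta> by (intro exI[of _ "2 * t + 2 + 2 * i"]) simp
      next
        case (4 i) then show ?thesis using g(6)[of i] \<beta> by (intro exI[of _ "2 * t + 3 + 2 * i"]) simp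
      qed
    qed
    then show "v \<in> g ` {0..<2 * \<beta>}" by auto
  qed
  \<comment> \<open>Surjectivity between sets of equal size yields injectivity, so the chosen
    vertices need not be shown distinct one by one.\<close>
  have "card (g ` {0..<2 * \<beta>}) \<le> card V"
    using card_image_le[of "{0..<2 * \<beta>}" g] card_V by simp
  then have img: "g ` {0..<2 * \<beta>} = V" using card_seteq[OF _ sub] by simp
  then have "inj_on g {0..<2 * \<beta>}" using card_V by (intro eq_card_imp_inj_on) simp_all
  then have "bij_betw g (Hstar_V \<beta> t) V" using img by (simp add: bij_betw_def Hstar_V_def)
  then show ?thesis using E_image Hstar_E_subset[OF t_less] by (rule graph_iso_if_image)
qed

end

context matched_graph
begin

text \<open>The vertex numbered 0 has 2 t + 1 neighbours from the triangles and the pendant edge and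
  \<open>\<beta> - t - 1\<close> from the paths. A lower bound suffices, as \<open>degree_le\<close>
  gives the other one.\<close>

lemma iso_Hstar_imp_degree:
  assumes "graph_iso V E (Hstar_V \<beta> t) (Hstar_E \<beta> t)"
  obtains c where "c \<in> V" "d c = \<beta> + t"
proof -
  obtain f where f: "bij_betw f V (Hstar_V \<beta> t)"
    "\<And>u v. u \<in> V \<Longrightarrow> v \<in> V \<Longrightarrow> {u, v} \<in> E \<longleftrightarrow> {f u, f v} \<in> Hstar_E \<beta> t"
    using assms unfolding graph_iso_def by blast
  let ?g = "inv_into V f"
  have gV: "?g n \<in> V" and fg: "f (?g n) = n" if "n < 2 * \<beta>" for n
    using f(1) that by (auto simp: bij_betw_def Hstar_V_def inv_into_into f_inv_into_f)
  let ?k = "\<beta> - t - 1"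
  let ?X = "{1..2 * t + 1}" and ?Y = "(\<lambda>j. 2 * t + 2 + 2 * j) ` {..<?k}"
  have lt: "n < 2 * \<beta>" if "n \<in> ?X \<union> ?Y" for n using that t_less by auto
  have nbr: "{0, n} \<in> Hstar_E \<beta> t" if "n \<in> ?X \<union> ?Y" for n
  proof -
    have "n = 2 * t + 1 \<or> (\<exists>i<t. n = 2 * i + 1) \<or> (\<exists>i<t. n = 2 * i + 2)" if n: "n \<in> ?X"
    proof (cases "odd n")
      case True
      then obtain i where "n = 2 * i + 1" by (rule oddE)
      then show ?thesis using n by (cases "i = t") auto
    next
      case False
      then obtain i where "n = 2 * i" by (auto elim: evenE)
      then have "n = 2 * (i - 1) + 2" "i - 1 < t" using n by auto
      then show ?thesis by blast
    qed
    then show ?thesis using that unfolding Hstar_E_def by fastforce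
  qed
  let ?c = "?g 0"
  have c: "?c \<in> V" "f ?c = 0" using gV fg \<beta>_ge_2 by simp_all
  have "card ?Y = ?k" by (subst card_image) (auto simp: inj_on_def)
  moreover have "?X \<inter> ?Y = {}" by auto
  ultimately have "card (?X \<union> ?Y) = \<beta> + t" using t_less by (subst card_Un_disjoint) auto
  moreover have "inj_on (\<lambda>n. {?c, ?g n}) (?X \<union> ?Y)"
  proof (rule inj_onI)
    fix m n assume mn: "m \<in> ?X \<union> ?Y" "n \<in> ?X \<union> ?Y" "{?c, ?g m} = {?c, ?g n}"
    then have "?g m = ?g n" by (auto simp: doubleton_eq_iff)
    then show "m = n" using fg lt mn(1,2) by metis
  qed
  moreover have "(\<lambda>n. {?c, ?g n}) ` (?X \<union> ?Y) \<subseteq> star ?c"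
  proof
    fix e assume "e \<in> (\<lambda>n. {?c, ?g n}) ` (?X \<union> ?Y)"
    then obtain n where n: "n \<in> ?X \<union> ?Y" "e = {?c, ?g n}" by blast
    then have "{?c, ?g n} \<in> E" using f(2)[OF c(1) gV[OF lt[OF n(1)]]] nbr[OF n(1)] fg lt c(2) by simp
    then show "e \<in> star ?c" using n(2) by (simp add: star_def)
  qed
  ultimately have "\<beta> + t \<le> d ?c" using card_mono[OF finite_star] card_star card_image by metis
  then show thesis using that[OF c(1)] degree_le[OF c(1)] by simp
qed

lemma extremal_iff:
  "sombor E \<le> Phi \<beta> t \<and> (sombor E = Phi \<beta> t \<longleftrightarrow> graph_iso V E (Hstar_V \<beta> t) (Hstar_E \<beta> t))"
proof (cases "\<exists>c\<in>V. d c = \<beta> + t")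
  case True
  then obtain c where "c \<in> V" "d c = \<beta> + t" by blast
  then interpret extremal_graph V E M \<beta> t c by unfold_locales
  show ?thesis using sombor_eq iso_Hstar by simp
next
  case False
  then have "sombor E < Phi \<beta> t"
    using degree_le by (intro sombor_less) (meson le_neq_implies_less)
  then show ?thesis using iso_Hstar_imp_degree False by (metis less_imp_le less_irrefl)
qed

end

theorem theorem4p4:
  fixes V :: "'a set" and E :: "'a set set" and \<beta> t :: nat
  assumes "\<beta> \<ge> 2"
    and "cactus V E"
    and "card V = 2 * \<beta>"
    and "card (cycles V E) = t"
    and "has_perfect_matching V E"
  shows "sombor E \<le> Phi \<beta> t \<and>
         (sombor E = Phi \<beta> t \<longleftrightarrow> graph_iso V E (Hstar_V \<beta> t) (Hstar_E \<beta> t))"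
proof -
  obtain M where M: "perfect_matching V E M" using assms(5) by (auto simp: has_perfect_matching_def)
  have "card E + 1 = 2 * \<beta> + t" using card_edges_cactus[OF assms(2)] assms(3,4) by simp
  \<comment> \<open>Together with the edge count this gives 2 t <= 2 \<beta> - 1, hence
    \<open>t + 1 \<le> \<beta>\<close>.\<close>
  moreover have "3 * t \<le> card E" using three_cycles_le_edges[OF assms(2)] assms(4) by simp
  ultimately interpret matched_graph V E M \<beta> t
    using assms M by unfold_locales (simp_all add: cactus_def)
  show ?thesis by (rule extremal_iff)
qed

end
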